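(* Let $\Delta\ge 3$ and $n\ge 3$. There exists an execution of the traversal procedure on $T_{n,\Delta}$ (i.e. a suitable choice of the children in step (b) and of the unmarked leaves in step (c)) whose output graph $G$ is planar. Consequently there is a planar hamiltonian graph on $n$ vertices with maximum degree at most $\Delta$ and diameter at most $2\,h(n,\Delta)$.
   Context: Fix integers $\Delta\ge 3$ and $n\ge 3$, and put $b=\Delta-1$. The complete $\Delta$-ary tree $T_{n,\Delta}$ is the rooted tree on vertex set $\{1,\dots,n\}$ with root $1$ in which the children of a vertex $i$ are the integers $j$ with $b(i-1)+2\le j\le bi+1$ and $j\le n$ (equivalently, the parent of $j\ge 2$ is $\lfloor (j-2)/b\rfloor+1$). Thus every vertex has at most $\Delta-1$ children, all levels except possibly the last are full, and the last level is filled from the left. A leaf is a vertex other than the root having no children. The height $h(n,\Delta)$ of $T_{n,\Delta}$ is the largest distance from the root to a vertex. Traversal procedure: start with edge set $E$ equal to the edge set of $T_{n,\Delta}$, all vertices unmarked, and $v_1=1$. For $k=1,\dots,n-1$: mark $v_k$; then (a) if $v_k\neq 1$ and the parent of $v_k$ is unmarked, let $v_{k+1}$ be the parent of $v_k$; (b) otherwise, if $v_k$ has an unmarked child, let $v_{k+1}$ be any unmarked child of $v_k$; (c) otherwise, let $v_{k+1}$ be any unmarked leaf $u$ and add the edge $\{v_k,u\}$ to $E$ (a "jump edge"). Finally mark $v_n$ and add the edge $\{v_n,1\}$ to $E$ (if not already present). The output is the simple graph $G=(\{1,\dots,n\},E)$. An execution is any run of this procedure, i.e. any admissible sequence of choices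 in (b) and (c). *)

theory Defs
  imports "HOL-Analysis.Analysis" "HOL-Library.Extended_Nat"
begin

definition simple_graph :: "'a set \<Rightarrow> 'a set set \<Rightarrow> bool" where
  "simple_graph V E \<longleftrightarrow> finite V \<and> (\<forall>e\<in>E. \<exists>u v. e = {u, v} \<and> u \<noteq> v \<and> u \<in> V \<and> v \<in> V)"

definition planar_embedding ::
  "'a set \<Rightarrow> 'a set set \<Rightarrow> ('a \<Rightarrow> complex) \<Rightarrow> ('a set \<Rightarrow> real \<Rightarrow> complex) \<Rightarrow> bool" where
  "planar_embedding V E p g \<longleftrightarrow>
     inj_on p V \<and>
     (\<forall>e\<in>E. \<exists>u v. e = {u, v} \<and> u \<noteq> v \<and> u \<in> V \<and> v \<in> V \<and>
        arc (g e) \<and> pathstart (g e) = p u \<and> pathfinish (g e) = p v \<and>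
        path_image (g e) \<inter> p ` V = {p u, p v}) \<and>
     (\<forall>e\<in>E. \<forall>e'\<in>E. e \<noteq> e' \<longrightarrow> path_image (g e) \<inter> path_image (g e') \<subseteq> p ` (e \<inter> e'))"

definition planar :: "'a set \<Rightarrow> 'a set set \<Rightarrow> bool" where
  "planar V E \<longleftrightarrow> (\<exists>p g. planar_embedding V E p g)"

definition degree :: "'a set set \<Rightarrow> 'a \<Rightarrow> nat" where
  "degree E v = card {e \<in> E. v \<in> e}"

definition walk :: "'a set set \<Rightarrow> 'a list \<Rightarrow> bool" where
  "walk E xs \<longleftrightarrow> xs \<noteq> [] \<and> (\<forall>i. Suc i < length xs \<longrightarrow> {xs ! i, xs ! Suc i} \<in> E)"

text \<open>Distance (\<infinity> if no walk) and diameter, valued in extended naturals.\<close>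

definition gdist :: "'a set \<Rightarrow> 'a set set \<Rightarrow> 'a \<Rightarrow> 'a \<Rightarrow> enat" where
  "gdist V E u v = (INF xs \<in> {xs. walk E xs \<and> set xs \<subseteq> V \<and> hd xs = u \<and> last xs = v}.
                      enat (length xs - 1))"

definition diameter :: "'a set \<Rightarrow> 'a set set \<Rightarrow> enat" where
  "diameter V E = (SUP u \<in> V. SUP v \<in> V. gdist V E u v)"

definition hamiltonian :: "'a set \<Rightarrow> 'a set set \<Rightarrow> bool" where
  "hamiltonian V E \<longleftrightarrow> (\<exists>cs. distinct cs \<and> set cs = V \<and> length cs \<ge> 3 \<and> walk E cs \<and>
                               {last cs, hd cs} \<in> E)"

section \<open>The complete \<Delta>-ary tree T(n,\<Delta>), with b = \<Delta> - 1\<close>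

definition tparent :: "nat \<Rightarrow> nat \<Rightarrow> nat" where
  "tparent b j = (j - 2) div b + 1"

definition tchildren :: "nat \<Rightarrow> nat \<Rightarrow> nat \<Rightarrow> nat set" where
  "tchildren n b i = {j. 2 \<le> j \<and> j \<le> n \<and> tparent b j = i}"

definition tleaf :: "nat \<Rightarrow> nat \<Rightarrow> nat \<Rightarrow> bool" where
  "tleaf n b v \<longleftrightarrow> 2 \<le> v \<and> v \<le> n \<and> tchildren n b v = {}"

definition tree_edges :: "nat \<Rightarrow> nat \<Rightarrow> nat set set" where
  "tree_edges n b = {{tparent b j, j} | j. 2 \<le> j \<and> j \<le> n}"

function depth :: "nat \<Rightarrow> nat \<Rightarrow> nat" where
  "depth b j = (if j \<le> 1 then 0 else Suc (depth b (tparent b j)))"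
  by auto
termination
proof (relation "Wellfounded.measure (\<lambda>(b, j). j)")
  fix b j :: nat
  assume "\<not> j \<le> 1"
  then show "((b, tparent b j), b, j) \<in> Wellfounded.measure (\<lambda>(b, j). j)"
  proof -
    have "(j - 2) div b \<le> j - 2" by (rule div_le_dividend)
    with \<open>\<not> j \<le> 1\<close> show ?thesis unfolding tparent_def in_measure split by linarith
  qed
qed auto

definition height :: "nat \<Rightarrow> nat \<Rightarrow> nat" where
  "height n \<Delta> = Max (depth (\<Delta> - 1) ` {1..n})"

text \<open>vs ! k is v_(k+1); when choosing vs ! (k+1) the marked vertices are set (take (k+1) vs).\<close>

definition case_a :: "nat \<Rightarrow> nat \<Rightarrow> nat list \<Rightarrow> nat \<Rightarrow> bool" where
  "case_a n b vs k \<longleftrightarrow> vs ! k \<noteq> 1 \<and> tparent b (vs ! k) \<notin> set (take (Suc k) vs)"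

definition case_b :: "nat \<Rightarrow> nat \<Rightarrow> nat list \<Rightarrow> nat \<Rightarrow> bool" where
  "case_b n b vs k \<longleftrightarrow> \<not> case_a n b vs k \<and>
      (\<exists>c \<in> tchildren n b (vs ! k). c \<notin> set (take (Suc k) vs))"

definition case_c :: "nat \<Rightarrow> nat \<Rightarrow> nat list \<Rightarrow> nat \<Rightarrow> bool" where
  "case_c n b vs k \<longleftrightarrow> \<not> case_a n b vs k \<and> \<not> case_b n b vs k"

definition execution :: "nat \<Rightarrow> nat \<Rightarrow> nat list \<Rightarrow> bool" where
  "execution n \<Delta> vs \<longleftrightarrow> (let b = \<Delta> - 1 in
     length vs = n \<and> vs ! 0 = 1 \<and>
     (\<forall>k. Suc k < n \<longrightarrow>
        (case_a n b vs k \<longrightarrow> vs ! Suc k = tparent b (vs ! k)) \<and>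
        (case_b n b vs k \<longrightarrow> vs ! Suc k \<in> tchildren n b (vs ! k) \<and>
                              vs ! Suc k \<notin> set (take (Suc k) vs)) \<and>
        (case_c n b vs k \<longrightarrow> tleaf n b (vs ! Suc k) \<and> vs ! Suc k \<notin> set (take (Suc k) vs))))"

definition jump_edges :: "nat \<Rightarrow> nat \<Rightarrow> nat list \<Rightarrow> nat set set" where
  "jump_edges n \<Delta> vs = {{vs ! k, vs ! Suc k} | k. Suc k < n \<and> case_c n (\<Delta> - 1) vs k}"

definition output_edges :: "nat \<Rightarrow> nat \<Rightarrow> nat list \<Rightarrow> nat set set" where
  "output_edges n \<Delta> vs = tree_edges n (\<Delta> - 1) \<union> jump_edges n \<Delta> vs \<union> {{vs ! (n - 1), 1}}"

end

(* An unmarked subtree whose root has a marked parent is called pending. At every jump, enter a leaf of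
   the pending subtree hanging off the most recently marked vertex. The traversal order is
   a Hamiltonian path, which is placed on the real axis, and every edge is drawn as a parabolic arc above
   or below the axis. An edge that is not on the path and does not close it joins a vertex c to its
   earlier parent, and c is the top of a climb that started with a jump. If the edge of a later c'
   crosses that of c, greediness forces the parent of c' to lie on the climb to c. Climbing uses path edges
   only, so the number of non-path edges between the root and c' exceeds that for c by exactly one,
   and drawing each edge on the page given by the parity of this number avoids all crossings. *)

theory Submission
  imports Defs
begin

section \<open>Two-page book embeddings\<close>

text \<open>All arcs are parabolas with the same leading coefficient up to sign, so of two arcs on
  one page over distinct nested intervals the outer one lies strictly farther from the axis inside
  the inner interval.\<close>

definition page_arc :: "bool \<Rightarrow> real \<Rightarrow> real \<Rightarrow> real \<Rightarrow> complex" where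
  "page_arc up a c t = (let x = a + t * (c - a) in
     Complex x ((if up then 1 else -1) * ((x - a) * (c - x))))"

lemma page_arc_ends: "pathstart (page_arc up a c) = of_real a" "pathfinish (page_arc up a c) = of_real c"
  by (auto simp: pathstart_def pathfinish_def page_arc_def Let_def complex_eq_iff)

lemma arc_page_arc:
  assumes "a < c"
  shows "arc (page_arc up a c)"
proof -
  have "continuous_on {0..1} (page_arc up a c)"
    unfolding page_arc_def Let_def Complex_eq by (intro continuous_intros)
  moreover have "inj_on (page_arc up a c) {0..1}"
    using assms by (auto simp: inj_on_def page_arc_def Let_def)
  ultimately show ?thesis
    by (simp add: arc_def path_def)
qed

lemma path_image_page_arc:
  assumes "a < c"
  shows "path_image (page_arc up a c) =
    {z. a \<le> Re z \<and> Re z \<le> c \<and> Im z = (if up then 1 else -1) * ((Re z - a) * (c - Re z))}"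
    (is "_ = ?R")
proof
  show "path_image (page_arc up a c) \<subseteq> ?R"
  proof
    fix z assume "z \<in> path_image (page_arc up a c)"
    then obtain t where t: "0 \<le> t" "t \<le> 1" and z: "z = page_arc up a c t"
      by (auto simp: path_image_def)
    have "0 \<le> t * (c - a)" using t assms by simp
    moreover have "t * (c - a) \<le> 1 * (c - a)" using t assms by (intro mult_right_mono) auto
    ultimately show "z \<in> ?R" by (simp add: z page_arc_def Let_def)
  qed
  show "?R \<subseteq> path_image (page_arc up a c)"
  proof
    fix z assume z: "z \<in> ?R"
    define t where "t = (Re z - a) / (c - a)"
    have t: "t \<in> {0..1}" and "a + t * (c - a) = Re z"
      using z assms by (auto simp: t_def divide_simps)
    then have "z = page_arc up a c t"
      using z by (simp add: page_arc_def Let_def complex_eq_iff)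
    with t show "z \<in> path_image (page_arc up a c)" by (auto simp: path_image_def)
  qed
qed

text \<open>Arcs on different pages lie on opposite sides of the axis. Arcs on one page could meet
  off the axis only over a point interior to both intervals; these are then nested, and the two
  heights there differ.\<close>

lemma page_arcs_meet:
  assumes "a < c" "a' < c'" "z \<in> path_image (page_arc up a c)" "z \<in> path_image (page_arc up' a' c')"
    and "(a, c) \<noteq> (a', c')"
    and "up = up' \<Longrightarrow> \<not> (a < a' \<and> a' < c \<and> c < c')"
    and "up = up' \<Longrightarrow> \<not> (a' < a \<and> a < c' \<and> c' < c)"
  shows "z \<in> {of_real a, of_real c} \<inter> {of_real a', of_real c'}"
proof -
  define x where "x = Re z"
  have x: "a \<le> x" "x \<le> c" "a' \<le> x" "x \<le> c'"
    and y: "Im z = (if up then 1 else -1) * ((x - a) * (c - x))"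
           "Im z = (if up' then 1 else -1) * ((x - a') * (c' - x))"
    using assms(3,4) by (auto simp: x_def path_image_page_arc assms(1,2))
  have nonneg: "0 \<le> (x - a) * (c - x)" "0 \<le> (x - a') * (c' - x)"
    using x by auto
  \<comment> \<open>Each factor for the inner interval is at most the matching factor for the outer
    one, so equal products force equal intervals.\<close>
  have outer: False if "p' \<le> p" "q \<le> q'" "(p, q) \<noteq> (p', q')" "p < x" "x < q"
    "(x - p) * (q - x) = (x - p') * (q' - x)" for p q p' q' :: real
  proof -
    have "(x - p) * (q - x) \<le> (x - p') * (q - x)"
      using that by (intro mult_right_mono) auto
    moreover have "(x - p') * (q - x) \<le> (x - p') * (q' - x)"
      using that by (intro mult_left_mono) auto
    ultimately have "(x - p) * (q - x) = (x - p') * (q - x)" "(x - p') * (q - x) = (x - p') * (q' - x)"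
      using that by linarith+
    then show False using that by auto
  qed
  have "(x - a) * (c - x) = 0 \<and> (x - a') * (c' - x) = 0"
  proof (cases "up = up'")
    case False
    have "A = 0 \<and> B = 0" if "0 \<le> A" "0 \<le> B" "w = (if up then 1 else -1) * A"
      "w = (if up' then 1 else -1) * B" for A B w :: real
      using that False by (auto split: if_splits)
    then show ?thesis using y nonneg by blast
  next
    case True
    then have eq: "(x - a) * (c - x) = (x - a') * (c' - x)"
      using y by (auto split: if_splits)
    show ?thesis
    proof (rule ccontr)
      assume "\<not> ?thesis"
      with eq have "(x - a) * (c - x) \<noteq> 0" "(x - a') * (c' - x) \<noteq> 0" by auto
      then have s: "a < x" "x < c" "a' < x" "x < c'"
        using x by (auto simp: less_le)
      \<comment> \<open>Both open intervals contain \<open>x\<close>; as they do not cross, one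
        contains the other.\<close>
      have "(a' \<le> a \<and> c \<le> c') \<or> (a \<le> a' \<and> c' \<le> c)"
        using assms(6,7)[OF True] s by linarith
      then show False
        using outer[of a' a c c'] outer[of a a' c' c] eq s assms(5) by auto
    qed
  qed
  then have "Im z = 0" "x = a \<or> x = c" "x = a' \<or> x = c'" using y by auto
  then show ?thesis by (auto simp: x_def complex_eq_iff)
qed

text \<open>The vertex \<open>vs ! i\<close> is placed at the real number \<open>i\<close>, and
  \<open>col\<close> selects the half-plane of each edge. Edges with interleaving ends get different
  pages, so \<open>page_arcs_meet\<close> leaves only common end vertices as intersection
  points.\<close>

lemma planar_book_embedding:
  fixes vs :: "'a list" and col :: "'a set \<Rightarrow> bool"
  assumes simple: "simple_graph (set vs) E" and dist: "distinct vs"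
    and nocross: "\<And>i i' j j'. i < i' \<Longrightarrow> i' < j \<Longrightarrow> j < j' \<Longrightarrow> j' < length vs \<Longrightarrow>
      {vs ! i, vs ! j} \<in> E \<Longrightarrow> {vs ! i', vs ! j'} \<in> E \<Longrightarrow>
      col {vs ! i, vs ! j} \<noteq> col {vs ! i', vs ! j'}"
  shows "planar (set vs) E"
proof -
  define pos where "pos = inv_into {..<length vs} (nth vs)"
  have inj: "inj_on (nth vs) {..<length vs}" using dist by (simp add: inj_on_nth)
  have pos_nth: "pos (vs ! i) = i" if "i < length vs" for i
    using inj that by (simp add: pos_def inv_into_f_f)
  define p :: "'a \<Rightarrow> complex" where "p x = of_real (real (pos x))" for x
  define g where "g e = page_arc (col e) (real (Min (pos ` e))) (real (Max (pos ` e)))" for e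
  have edge: "\<exists>i j. i < j \<and> j < length vs \<and> e = {vs ! i, vs ! j}" if e: "e \<in> E" for e
  proof -
    obtain u v where uv: "e = {u, v}" "u \<noteq> v" "u \<in> set vs" "v \<in> set vs"
      using simple e by (auto simp: simple_graph_def)
    then obtain i j where ij: "i < length vs" "u = vs ! i" "j < length vs" "v = vs ! j"
      by (metis in_set_conv_nth)
    have "i < j \<or> j < i" using uv ij by (metis nat_neq_iff)
    then show ?thesis using uv ij by (metis insert_commute)
  qed
  have g: "g {vs ! i, vs ! j} = page_arc (col {vs ! i, vs ! j}) (real i) (real j)"
    if "i < j" "j < length vs" for i j
    using that by (simp add: g_def pos_nth min_def max_def)
  have p_inj: "inj_on p (set vs)"
    by (rule inj_onI) (metis p_def in_set_conv_nth of_nat_eq_iff of_real_eq_iff pos_nth)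
  have p_nth: "p (vs ! i) = of_real (real i)" if "i < length vs" for i
    using that by (simp add: p_def pos_nth)
  have "planar_embedding (set vs) E p g"
    unfolding planar_embedding_def
  proof (intro conjI ballI impI)
    show "inj_on p (set vs)" by (rule p_inj)
  next
    fix e assume e: "e \<in> E"
    obtain i j where ij: "i < j" "j < length vs" "e = {vs ! i, vs ! j}" using edge[OF e] by blast
    have ge: "g e = page_arc (col e) (real i) (real j)" using g ij by simp
    have "path_image (g e) \<inter> p ` set vs = {p (vs ! i), p (vs ! j)}"
    proof
      show "{p (vs ! i), p (vs ! j)} \<subseteq> path_image (g e) \<inter> p ` set vs"
        using ij pathstart_in_path_image[of "g e"] pathfinish_in_path_image[of "g e"] p_nth
        unfolding ge page_arc_ends by (simp del: of_real_of_nat_eq) (metis imageI nth_mem order.strict_trans)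
      show "path_image (g e) \<inter> p ` set vs \<subseteq> {p (vs ! i), p (vs ! j)}"
      proof
        fix z assume z: "z \<in> path_image (g e) \<inter> p ` set vs"
        then obtain k where k: "k < length vs" "z = of_real (real k)"
          by (auto simp: in_set_conv_nth p_nth)
        moreover have "z \<in> path_image (page_arc (col e) (real i) (real j))" using z ge by simp
        \<comment> \<open>Vertices have imaginary part 0, and a parabola meets the axis only at its
          two ends.\<close>
        ultimately have "(real k - real i) * (real j - real k) = 0"
          using ij by (simp add: path_image_page_arc split: if_splits)
        then have "k = i \<or> k = j" by auto
        then show "z \<in> {p (vs ! i), p (vs ! j)}" using k p_nth by auto
      qed
    qed
    moreover have "vs ! i \<noteq> vs ! j" using ij dist by (simp add: nth_eq_iff_index_eq)
    moreover have "arc (g e)" "pathstart (g e) = p (vs ! i)" "pathfinish (g e) = p (vs ! j)"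
      unfolding ge using ij by (simp_all add: arc_page_arc page_arc_ends p_nth)
    ultimately show "\<exists>u v. e = {u, v} \<and> u \<noteq> v \<and> u \<in> set vs \<and> v \<in> set vs \<and> arc (g e) \<and>
        pathstart (g e) = p u \<and> pathfinish (g e) = p v \<and> path_image (g e) \<inter> p ` set vs = {p u, p v}"
      using ij by (intro exI[of _ "vs ! i"] exI[of _ "vs ! j"]) simp
  next
    fix e e' assume e: "e \<in> E" and e': "e' \<in> E" and ne: "e \<noteq> e'"
    obtain i j where ij: "i < j" "j < length vs" "e = {vs ! i, vs ! j}" using edge[OF e] by blast
    obtain i' j' where ij': "i' < j'" "j' < length vs" "e' = {vs ! i', vs ! j'}"
      using edge[OF e'] by blast
    show "path_image (g e) \<inter> path_image (g e') \<subseteq> p ` (e \<inter> e')"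
    proof
      fix z assume z: "z \<in> path_image (g e) \<inter> path_image (g e')"
      have "z \<in> {of_real (real i), of_real (real j)} \<inter> {of_real (real i'), of_real (real j')}"
      proof (rule page_arcs_meet)
        show "z \<in> path_image (page_arc (col e) (real i) (real j))"
          "z \<in> path_image (page_arc (col e') (real i') (real j'))"
          using z g ij ij' by auto
        show "(real i, real j) \<noteq> (real i', real j')" using ne ij ij' by auto
        show "\<not> (real i < real i' \<and> real i' < real j \<and> real j < real j')" if "col e = col e'"
          using nocross[of i i' j j'] ij ij' e e' that by auto
        show "\<not> (real i' < real i \<and> real i < real j' \<and> real j' < real j)" if "col e = col e'"
          using nocross[of i' i j' j] ij ij' e e' that by auto
      qed (use ij ij' in auto)
      then obtain k where "k \<in> {i, j}" "k \<in> {i', j'}" "z = of_real (real k)" by auto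
      then have "z = p (vs ! k)" "vs ! k \<in> e \<inter> e'" using ij ij' p_nth by auto
      then show "z \<in> p ` (e \<inter> e')" by blast
    qed
  qed
  then show ?thesis by (auto simp: planar_def)
qed

section \<open>Greedy runs of the traversal procedure\<close>

lemma tparent_less: "2 \<le> x \<Longrightarrow> tparent b x < x"
  unfolding tparent_def using div_le_dividend[of "x - 2" b] by linarith

lemma tparent_ge1: "1 \<le> tparent b x"
  by (simp add: tparent_def)

text \<open>Truncated subtraction makes the root its own parent, so closure of the marked set under
  \<open>tparent\<close> needs no exception for it.\<close>

lemma tparent_1: "tparent b (Suc 0) = Suc 0"
  by (simp add: tparent_def)

text \<open>The case at position \<open>k\<close> depends only on the first \<open>Suc k\<close>
  entries, so extending a run does not change its earlier steps.\<close>

lemma case_append: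
  assumes "k < length xs"
  shows "case_a n b (xs @ ys) k \<longleftrightarrow> case_a n b xs k"
    "case_b n b (xs @ ys) k \<longleftrightarrow> case_b n b xs k"
    "case_c n b (xs @ ys) k \<longleftrightarrow> case_c n b xs k"
  using assms by (auto simp: case_a_def case_b_def case_c_def nth_append)

text \<open>The unmarked ancestor of the new leaf with marked parent \<open>vs ! l\<close> is the root of the pending
  subtree entered by the jump; no vertex marked after \<open>vs ! l\<close> has an unmarked child.\<close>

definition greedy_jump :: "nat \<Rightarrow> nat \<Rightarrow> nat list \<Rightarrow> nat \<Rightarrow> bool" where
  "greedy_jump n b vs k \<longleftrightarrow>
     (\<forall>m\<le>k. \<forall>l<m. \<forall>j. (tparent b ^^ j) (vs ! Suc k) \<notin> set (take (Suc k) vs) \<longrightarrow>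
        vs ! l = tparent b ((tparent b ^^ j) (vs ! Suc k)) \<longrightarrow>
        tchildren n b (vs ! m) \<subseteq> set (take (Suc k) vs))"

definition greedy_step :: "nat \<Rightarrow> nat \<Rightarrow> nat list \<Rightarrow> nat \<Rightarrow> bool" where
  "greedy_step n b vs k \<longleftrightarrow>
     (case_a n b vs k \<longrightarrow> vs ! Suc k = tparent b (vs ! k)) \<and>
     (case_b n b vs k \<longrightarrow> vs ! Suc k \<in> tchildren n b (vs ! k) \<and> vs ! Suc k \<notin> set (take (Suc k) vs)) \<and>
     (case_c n b vs k \<longrightarrow> tleaf n b (vs ! Suc k) \<and> vs ! Suc k \<notin> set (take (Suc k) vs) \<and>
        greedy_jump n b vs k)"

lemma greedy_step_append:
  assumes "Suc k < length xs"
  shows "greedy_step n b (xs @ ys) k \<longleftrightarrow> greedy_step n b xs k"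
proof -
  have "greedy_jump n b (xs @ ys) k \<longleftrightarrow> greedy_jump n b xs k"
    using assms by (simp add: greedy_jump_def nth_append)
  then show ?thesis using assms by (simp add: greedy_step_def case_append nth_append)
qed

locale greedy_run =
  fixes n b :: nat and vs :: "nat list"
  assumes n_pos: "1 \<le> n" and nonempty: "vs \<noteq> []" and start: "vs ! 0 = 1"
    and step: "Suc k < length vs \<Longrightarrow> greedy_step n b vs k"
begin

section \<open>Order in which a greedy run marks the vertices\<close>

lemma fresh: "Suc k < length vs \<Longrightarrow> vs ! Suc k \<notin> set (take (Suc k) vs)"
  using step[of k] by (auto simp: greedy_step_def case_c_def case_a_def)

lemma nth_distinct: "i < j \<Longrightarrow> j < length vs \<Longrightarrow> vs ! i \<noteq> vs ! j"
  using fresh[of "j - 1"] by (auto simp: in_set_conv_nth)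

lemma distinct_vs: "distinct vs"
  unfolding distinct_conv_nth by (metis nat_neq_iff nth_distinct)

lemma nth_eq: "i < length vs \<Longrightarrow> j < length vs \<Longrightarrow> vs ! i = vs ! j \<longleftrightarrow> i = j"
  by (simp add: distinct_vs nth_eq_iff_index_eq)

lemma nth_range: "i < length vs \<Longrightarrow> vs ! i \<in> {1..n}"
proof (induction i)
  case 0
  then show ?case using start n_pos by simp
next
  case (Suc i)
  then have r: "vs ! i \<in> {1..n}" by simp
  have "tparent b (vs ! i) \<in> {1..n}" if "vs ! i \<noteq> 1"
    using tparent_less[of "vs ! i" b] tparent_ge1[of b "vs ! i"] that r by auto
  then show ?case
    using step[OF Suc.prems] r
    by (auto simp: greedy_step_def case_c_def case_a_def tleaf_def tchildren_def)
qed

lemma set_vs: "set vs \<subseteq> {1..n}"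
  using nth_range by (auto simp: in_set_conv_nth)

lemma nth_ge2: "0 < i \<Longrightarrow> i < length vs \<Longrightarrow> 2 \<le> vs ! i"
  using nth_range[of i] nth_distinct[of 0 i] start by force

text \<open>If the parent of \<open>vs ! i\<close> is unmarked when \<open>vs ! i\<close> is
  current, rule (a) marks it next. Hence only the current vertex can have an unmarked
  parent.\<close>

lemma parent_marked:
  assumes "i < k" "k < length vs"
  shows "tparent b (vs ! i) \<in> set (take (Suc k) vs)"
proof (cases "case_a n b vs i")
  case True
  then have "tparent b (vs ! i) = vs ! Suc i" using step[of i] assms by (simp add: greedy_step_def)
  then show ?thesis using assms by (auto simp: in_set_conv_nth intro!: exI[of _ "Suc i"])
next
  case False
  show ?thesis
  proof (cases "vs ! i = 1")
    case True
    then show ?thesis using start assms by (auto simp: tparent_1 in_set_conv_nth intro!: exI[of _ 0])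
  next
    case nr: False
    then have "tparent b (vs ! i) \<in> set (take (Suc i) vs)" using False by (simp add: case_a_def)
    then show ?thesis using assms set_take_subset_set_take[of "Suc i" "Suc k" vs] by auto
  qed
qed

text \<open>Outside case (a) the current vertex has a marked parent too. Thus whenever a jump is
  due, every descendant of an unmarked vertex is unmarked.\<close>

lemma parent_closed:
  assumes "k < length vs" "\<not> case_a n b vs k" "x \<in> set (take (Suc k) vs)"
  shows "tparent b x \<in> set (take (Suc k) vs)"
proof -
  obtain i where i: "i \<le> k" "x = vs ! i"
    using assms by (auto simp: in_set_conv_nth less_Suc_eq_le)
  show ?thesis
  proof (cases "i = k \<and> x \<noteq> 1")
    case True
    then show ?thesis using assms i by (auto simp: case_a_def)
  next
    case False
    then show ?thesis using i assms parent_marked[of i k] start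
      by (cases "i = k") (auto simp: tparent_1)
  qed
qed

lemma funpow_parent_closed:
  assumes "k < length vs" "\<not> case_a n b vs k" "x \<in> set (take (Suc k) vs)"
  shows "(tparent b ^^ i) x \<in> set (take (Suc k) vs)"
  using assms parent_closed by (induction i) auto

section \<open>Existence of greedy jumps and of full greedy runs\<close>

lemma ex_leaf_below:
  assumes "2 \<le> c" "c \<le> n"
  shows "\<exists>w i. tleaf n b w \<and> (tparent b ^^ i) w = c"
proof -
  \<comment> \<open>These are the descendants of \<open>c\<close>, including \<open>c\<close>.
    Children have larger labels than their parents, so the largest element is a leaf.\<close>
  define D where "D = {y. 2 \<le> y \<and> y \<le> n \<and> (\<exists>i. (tparent b ^^ i) y = c)}"
  have fin: "finite D" by (rule finite_subset[of _ "{..n}"]) (auto simp: D_def)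
  have "c \<in> D" using assms by (auto simp: D_def intro: exI[of _ 0])
  then have w: "Max D \<in> D" using Max_in[OF fin] by blast
  then obtain i where i: "(tparent b ^^ i) (Max D) = c" by (auto simp: D_def)
  have "tchildren n b (Max D) = {}"
  proof (rule ccontr)
    assume "tchildren n b (Max D) \<noteq> {}"
    then obtain y where y: "2 \<le> y" "y \<le> n" "tparent b y = Max D" by (auto simp: tchildren_def)
    then have "(tparent b ^^ Suc i) y = c" using i by (simp add: funpow_swap1)
    then have "y \<in> D" using y by (auto simp: D_def simp del: funpow.simps)
    then show False using Max_ge[OF fin, of y] tparent_less[of y b] y by simp
  qed
  then show ?thesis using i w by (auto simp: tleaf_def D_def)
qed

text \<open>Take the latest marked vertex \<open>vs ! m\<close> with an unmarked child
  \<open>c\<close> and any leaf \<open>w\<close> below \<open>c\<close>; were \<open>w\<close>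
  marked, closure under parents would make \<open>c\<close> marked.\<close>

lemma ex_jump:
  assumes short: "length vs < n" and c: "case_c n b vs (length vs - 1)"
  shows "\<exists>w. tleaf n b w \<and> w \<notin> set vs \<and> greedy_jump n b (vs @ [w]) (length vs - 1)"
proof -
  define k where "k = length vs - 1"
  have k: "k < length vs" "Suc k = length vs" using nonempty by (auto simp: k_def)
  have na: "\<not> case_a n b vs k" using c by (simp add: case_c_def k_def)
  have closed: "(tparent b ^^ i) x \<in> set vs" if "x \<in> set vs" for x i
    using funpow_parent_closed[OF k(1) na, of x i] that k by simp
  define Q where "Q = (\<lambda>m. m \<le> k \<and> \<not> tchildren n b (vs ! m) \<subseteq> set vs)"
  have "\<exists>m. Q m"
  proof -
    have "card (set vs) < card {1..n}" using short distinct_vs by (simp add: distinct_card)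
    then have ex: "\<exists>z. z \<in> {1..n} \<and> z \<notin> set vs" by (metis card_mono finite_set not_le subsetI)
    \<comment> \<open>The least unmarked vertex has a smaller, hence marked, parent, which is a
      witness for \<open>Q\<close>.\<close>
    define z where "z = (LEAST z. z \<in> {1..n} \<and> z \<notin> set vs)"
    have z: "z \<in> {1..n}" "z \<notin> set vs" using LeastI_ex[OF ex] by (auto simp: z_def)
    have "z \<noteq> 1" using z start nonempty by (metis length_greater_0_conv nth_mem)
    then have z2: "2 \<le> z" using z by auto
    have "tparent b z \<in> set vs"
      using not_less_Least[of "tparent b z", folded z_def, of "\<lambda>z. z \<in> {1..n} \<and> z \<notin> set vs"]
        tparent_less[OF z2, of b] tparent_ge1[of b z] z
      by (auto simp: z_def)
    then obtain m where "m \<le> k" "vs ! m = tparent b z" using k by (metis in_set_conv_nth less_Suc_eq_le)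
    then have "Q m" using z z2 by (auto simp: Q_def tchildren_def)
    then show ?thesis ..
  qed
  moreover have bound: "\<And>m. Q m \<Longrightarrow> m \<le> k" by (simp add: Q_def)
  ultimately have Qm: "Q (Greatest Q)" and Q_max: "\<And>m. Q m \<Longrightarrow> m \<le> Greatest Q"
    by (metis GreatestI_nat, metis Greatest_le_nat)
  define m where "m = Greatest Q"
  obtain c where c: "2 \<le> c" "c \<le> n" "tparent b c = vs ! m" "c \<notin> set vs" and mk: "m \<le> k"
    using Qm by (auto simp: Q_def m_def tchildren_def)
  obtain w i where w: "tleaf n b w" "(tparent b ^^ i) w = c" using ex_leaf_below[OF c(1,2)] by blast
  have "w \<notin> set vs" using closed[of w i] w c by auto
  moreover have "greedy_jump n b (vs @ [w]) k"
    unfolding greedy_jump_def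
  proof (intro allI impI)
    fix m' l j
    assume x: "(tparent b ^^ j) ((vs @ [w]) ! Suc k) \<notin> set (take (Suc k) (vs @ [w]))"
      and l: "(vs @ [w]) ! l = tparent b ((tparent b ^^ j) ((vs @ [w]) ! Suc k))"
      and m': "m' \<le> k" "l < m'"
    have x': "(tparent b ^^ j) w \<notin> set vs" and l': "vs ! l = tparent b ((tparent b ^^ j) w)"
      using x l m' k by (auto simp: nth_append)
    \<comment> \<open>On the way from \<open>w\<close> to the root, every vertex after the first
      marked one is marked. So only one unmarked ancestor of \<open>w\<close> has a marked parent,
      and that ancestor is \<open>c\<close>.\<close>
    have up: "(tparent b ^^ i2) w \<in> set vs" if "i1 < i2" "tparent b ((tparent b ^^ i1) w) \<in> set vs" for i1 i2
    proof -
      have "(tparent b ^^ i2) w = (tparent b ^^ (i2 - Suc i1)) ((tparent b ^^ Suc i1) w)"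
        using that by (metis Suc_leI funpow_add le_add_diff_inverse2 o_apply)
      then show ?thesis using closed that by simp
    qed
    have "vs ! l \<in> set vs" "vs ! m \<in> set vs" using m' mk k by auto
    then have "i = j" using up[of i j] up[of j i] x' l' w c by (metis nat_neq_iff)
    then have "vs ! l = vs ! m" using l' w c by simp
    \<comment> \<open>The pending subtree entered hangs off \<open>vs ! m\<close>, and by the choice
      of \<open>m\<close> no vertex marked later has an unmarked child.\<close>
    then have "l = m" using nth_eq[of l m] m' mk k by simp
    then have "\<not> Q m'" using Q_max[of m'] m' by (auto simp: m_def)
    then show "tchildren n b ((vs @ [w]) ! m') \<subseteq> set (take (Suc k) (vs @ [w]))"
      using m' k by (auto simp: Q_def nth_append)
  qed
  ultimately show ?thesis using w by (auto simp: k_def)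
qed

text \<open>Rules (a) and (b) supply the next vertex themselves; only (c) needs an argument, given
  by \<open>ex_jump\<close>.\<close>

lemma ex_extension:
  assumes "length vs < n"
  shows "\<exists>y. greedy_run n b (vs @ [y])"
proof -
  define k where "k = length vs - 1"
  have k: "k < length vs" "Suc k = length vs" using nonempty by (auto simp: k_def)
  have "\<exists>y. greedy_step n b (vs @ [y]) k"
  proof (cases "case_c n b vs k")
    case True
    then obtain w where "tleaf n b w" "w \<notin> set vs" "greedy_jump n b (vs @ [w]) k"
      using ex_jump[OF assms] by (auto simp: k_def)
    then show ?thesis using True k
      by (intro exI[of _ w]) (auto simp: greedy_step_def case_append case_c_def nth_append)
  next
    case nc: False
    show ?thesis
    proof (cases "case_a n b vs k")
      case True
      then show ?thesis using nc k
        by (intro exI[of _ "tparent b (vs ! k)"])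
           (auto simp: greedy_step_def case_append case_b_def nth_append)
    next
      case False
      then have "case_b n b vs k" using nc by (simp add: case_c_def)
      then obtain y where "y \<in> tchildren n b (vs ! k)" "y \<notin> set vs" using k by (auto simp: case_b_def)
      then show ?thesis using nc False k
        by (intro exI[of _ y]) (auto simp: greedy_step_def case_append nth_append)
    qed
  qed
  then obtain y where y: "greedy_step n b (vs @ [y]) k" ..
  have "greedy_run n b (vs @ [y])"
  proof
    fix j assume "Suc j < length (vs @ [y])"
    then consider "Suc j < length vs" | "j = k" using k by force
    then show "greedy_step n b (vs @ [y]) j"
      using y step[of j] greedy_step_append[of j vs n b "[y]"] by cases auto
  qed (use n_pos nonempty start in \<open>auto simp: nth_append\<close>)
  then show ?thesis ..
qed

end

lemma ex_greedy_run:
  assumes "1 \<le> k" "k \<le> n"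
  shows "\<exists>vs. greedy_run n b vs \<and> length vs = k"
  using assms
proof (induction k rule: nat_induct_at_least)
  case base
  have "greedy_run n b [1]" by unfold_locales (use base in auto)
  then show ?case by (intro exI[of _ "[1]"]) auto
next
  case (Suc k)
  then obtain vs where vs: "greedy_run n b vs" "length vs = k" by auto
  then obtain y where "greedy_run n b (vs @ [y])"
    using greedy_run.ex_extension[of n b vs] Suc.prems by auto
  then show ?case using vs by (intro exI[of _ "vs @ [y]"]) auto
qed

section \<open>Greedy traversals\<close>

definition path_adj :: "'a list \<Rightarrow> 'a \<Rightarrow> 'a \<Rightarrow> bool" where
  "path_adj vs x y \<longleftrightarrow> (\<exists>k. Suc k < length vs \<and> {vs ! k, vs ! Suc k} = {x, y})"

text \<open>The parity of \<open>lev b vs x\<close> is the page on which the edge from \<open>x\<close> to its parent is drawn.\<close>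

function lev :: "nat \<Rightarrow> nat list \<Rightarrow> nat \<Rightarrow> nat" where
  "lev b vs x = (if x \<le> 1 then 0
     else lev b vs (tparent b x) + (if path_adj vs (tparent b x) x then 0 else 1))"
  by auto
termination
  by (relation "Wellfounded.measure (\<lambda>(b, vs, x). x)") (auto intro: tparent_less)

declare lev.simps [simp del] depth.simps [simp del]

lemma walk_iff_successively:
  "walk E xs \<longleftrightarrow> xs \<noteq> [] \<and> successively (\<lambda>x y. {x, y} \<in> E) xs"
  by (auto simp: walk_def successively_conv_nth)

text \<open>Siblings \<open>j\<close> share the quotient of \<open>j - 2\<close> by
  \<open>b\<close>, so the remainder, which has \<open>b\<close> possible values, tells them
  apart.\<close>

lemma card_tchildren_le: "1 \<le> b \<Longrightarrow> card (tchildren n b v) \<le> b"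
proof -
  assume b: "1 \<le> b"
  have "inj_on (\<lambda>j. (j - 2) mod b) (tchildren n b v)"
  proof (rule inj_onI)
    fix i j assume ij: "i \<in> tchildren n b v" "j \<in> tchildren n b v" "(i - 2) mod b = (j - 2) mod b"
    then have "(i - 2) div b = (j - 2) div b" by (auto simp: tchildren_def tparent_def)
    then have "i - 2 = j - 2" using ij by (metis div_mult_mod_eq)
    then show "i = j" using ij by (auto simp: tchildren_def)
  qed
  moreover have "(\<lambda>j. (j - 2) mod b) ` tchildren n b v \<subseteq> {..<b}" using b by auto
  ultimately have "card (tchildren n b v) \<le> card {..<b}" by (intro card_inj_on_le) auto
  then show ?thesis by simp
qed

locale greedy_traversal = greedy_run +
  assumes full: "length vs = n" and n3: "3 \<le> n" and b2: "2 \<le> b"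
begin

text \<open>Writing \<Delta> as \<open>Suc b\<close> removes the truncated subtraction from the
  number of children.\<close>

abbreviation "E \<equiv> output_edges n (Suc b) vs"

lemma set_vs_eq: "set vs = {1..n}"
  using set_vs distinct_vs full by (intro card_subset_eq) (auto simp: distinct_card)

lemma greedy_execution: "execution n (Suc b) vs"
  using start step full by (auto simp: execution_def greedy_step_def)

lemma edge_cases:
  assumes "e \<in> E"
  obtains (tree) x where "2 \<le> x" "x \<le> n" "e = {tparent b x, x}"
    | (jump) k where "Suc k < n" "case_c n b vs k" "e = {vs ! k, vs ! Suc k}"
    | (closing) "e = {vs ! (n - 1), vs ! 0}"
  using assms start by (auto simp: output_edges_def tree_edges_def jump_edges_def)

lemma tree_edge: "2 \<le> x \<Longrightarrow> x \<le> n \<Longrightarrow> {tparent b x, x} \<in> E"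
  by (auto simp: output_edges_def tree_edges_def)

lemma simple: "simple_graph {1..n} E"
  unfolding simple_graph_def
proof (intro conjI ballI)
  fix e assume "e \<in> E"
  then show "\<exists>u v. e = {u, v} \<and> u \<noteq> v \<and> u \<in> {1..n} \<and> v \<in> {1..n}"
  proof (cases rule: edge_cases)
    case (tree x)
    then show ?thesis using tparent_less[of x b] tparent_ge1[of b x]
      by (intro exI[of _ "tparent b x"] exI[of _ x]) auto
  next
    case (jump k)
    then show ?thesis using nth_distinct[of k "Suc k"] nth_range[of k] nth_range[of "Suc k"] full
      by (intro exI[of _ "vs ! k"] exI[of _ "vs ! Suc k"]) auto
  next
    case closing
    then show ?thesis using nth_distinct[of 0 "n - 1"] nth_range[of 0] nth_range[of "n - 1"] full n3
      by (intro exI[of _ "vs ! (n - 1)"] exI[of _ "vs ! 0"]) auto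
  qed
qed simp

section \<open>Levels and crossings of tree edges\<close>

lemma climb_step:
  assumes "i < j" "j < n" "vs ! j = tparent b (vs ! i)" "2 \<le> vs ! i"
  shows "j = Suc i"
proof -
  \<comment> \<open>The parent is still unmarked when \<open>vs ! i\<close> is current, so rule (a)
    moves to it at once.\<close>
  have "vs ! j \<notin> set (take (Suc i) vs)"
    using assms(1,2) full by (auto simp: in_set_conv_nth nth_eq)
  then have "case_a n b vs i" using assms by (auto simp: case_a_def)
  then have "vs ! Suc i = vs ! j" using step[of i] assms full by (simp add: greedy_step_def)
  then show ?thesis using assms(1,2) nth_eq[of j "Suc i"] full by simp
qed

text \<open>Jump edges join consecutive positions, and so do tree edges whose child is marked first.
  This leaves tree edges whose parent is marked first.\<close>

lemma long_edge:
  assumes e: "{vs ! i, vs ! j} \<in> E" and ij: "Suc i < j" "j < n" and nc: "(i, j) \<noteq> (0, n - 1)"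
  shows "vs ! i = tparent b (vs ! j) \<and> 2 \<le> vs ! j"
  using e
proof (cases rule: edge_cases)
  case (tree x)
  then show ?thesis using climb_step[of i j] ij by (auto simp: doubleton_eq_iff)
next
  case (jump k)
  then show ?thesis using ij full by (auto simp: doubleton_eq_iff nth_eq)
next
  case closing
  then show ?thesis using ij full nc n3 by (auto simp: doubleton_eq_iff nth_eq)
qed

lemma lev_path:
  assumes "Suc m < n" "case_a n b vs m"
  shows "lev b vs (vs ! m) = lev b vs (vs ! Suc m)"
proof -
  have p: "vs ! Suc m = tparent b (vs ! m)" and ne: "vs ! m \<noteq> 1"
    using step[of m] assms full by (auto simp: greedy_step_def case_a_def)
  have "2 \<le> vs ! m" using ne nth_range[of m] assms full by auto
  moreover have "path_adj vs (tparent b (vs ! m)) (vs ! m)"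
    unfolding path_adj_def using p assms full by (intro exI[of _ m]) auto
  ultimately show ?thesis using p by (simp add: lev.simps[of b vs "vs ! m"])
qed

text \<open>The entries of \<open>vs\<close> are distinct, so an edge between positions more than
  one apart is not a path edge and is counted.\<close>

lemma lev_long:
  assumes "Suc i < j" "j < n" "vs ! i = tparent b (vs ! j)" "2 \<le> vs ! j"
  shows "lev b vs (vs ! j) = Suc (lev b vs (vs ! i))"
proof -
  have "\<not> path_adj vs (tparent b (vs ! j)) (vs ! j)"
    using assms full by (auto simp: path_adj_def doubleton_eq_iff nth_eq simp flip: assms(3))
  then show ?thesis using assms by (simp add: lev.simps[of b vs "vs ! j"])
qed

text \<open>If the parent edges of \<open>vs ! j\<close> and \<open>vs ! j'\<close> cross, then \<open>vs ! i'\<close> lies on the climb from the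
  jump target up to \<open>vs ! j\<close>: had it been marked before that jump, then greediness
  would have preferred its child \<open>vs ! j'\<close> to \<open>vs ! j\<close>.\<close>

lemma lev_crossing:
  assumes ord: "i < i'" "i' < j" "j < j'" "j' < n"
    and p: "vs ! i = tparent b (vs ! j)" and p': "vs ! i' = tparent b (vs ! j')"
  shows "lev b vs (vs ! j') = Suc (lev b vs (vs ! j))"
proof -
  \<comment> \<open>The least such \<open>s\<close> is the start of the maximal climb ending at
    \<open>vs ! j\<close>; the climb is empty if \<open>s = j\<close>.\<close>
  define S where "S = (\<lambda>s. s \<le> j \<and> (\<forall>m. s \<le> m \<longrightarrow> m < j \<longrightarrow> case_a n b vs m))"
  define s where "s = (LEAST s. S s)"
  have "S j" by (simp add: S_def)
  then have "S s" unfolding s_def by (rule LeastI)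
  then have sj: "s \<le> j" and climb: "\<And>m. s \<le> m \<Longrightarrow> m < j \<Longrightarrow> case_a n b vs m"
    by (auto simp: S_def)
  have ge2: "2 \<le> vs ! j" "2 \<le> vs ! j'" using nth_ge2 ord full by auto
  have lev_climb: "lev b vs (vs ! m) = lev b vs (vs ! j)" if "s \<le> m" "m \<le> j" for m
    using that(2,1)
  proof (induction m rule: inc_induct)
    case (step m)
    then show ?case using lev_path[of m] climb[of m] ord by simp
  qed simp
  have pow: "(tparent b ^^ t) (vs ! s) = vs ! (s + t)" if "s + t \<le> j" for t
    using that
  proof (induction t)
    case (Suc t)
    then have "vs ! Suc (s + t) = tparent b (vs ! (s + t))"
      using climb[of "s + t"] step[of "s + t"] ord full by (simp add: greedy_step_def)
    then show ?case using Suc by simp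
  qed simp
  have "s \<noteq> 0" using climb[of 0] ord start by (auto simp: case_a_def)
  then obtain r where r: "s = Suc r" by (cases s) auto
  have "\<not> S r" using not_less_Least[of r S] r by (simp add: s_def)
  then have na: "\<not> case_a n b vs r" using r sj climb by (auto simp: S_def) (metis le_antisym not_less_eq_eq)
  \<comment> \<open>After a descent from \<open>vs ! r\<close> the parent of \<open>vs ! s\<close>
    is already marked, so no climb follows and \<open>s = j\<close>. But then
    \<open>i = r = j - 1\<close>, which leaves no room for \<open>i'\<close>.\<close>
  have "\<not> case_b n b vs r"
  proof
    assume "case_b n b vs r"
    then have ps: "tparent b (vs ! s) = vs ! r"
      using step[of r] r sj ord full by (simp add: greedy_step_def tchildren_def)
    show False
    proof (cases "s = j")
      case True
      then have "vs ! i = vs ! r" using ps p by simp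
      then have "i = r" using r True ord full by (simp add: nth_eq)
      then show False using ord r True by simp
    next
      case False
      then have "case_a n b vs s" using climb sj by simp
      then have "vs ! r \<notin> set (take (Suc s) vs)" using ps by (simp add: case_a_def)
      moreover have "vs ! r \<in> set (take (Suc s) vs)"
        using r sj ord full by (auto simp: in_set_conv_nth intro!: exI[of _ r])
      ultimately show False by simp
    qed
  qed
  then have "case_c n b vs r" using na by (simp add: case_c_def)
  then have greedy: "greedy_jump n b vs r"
    using step[of r] r sj ord full by (simp add: greedy_step_def)
  \<comment> \<open>Otherwise \<open>vs ! j\<close>, lying \<open>j - s\<close> parents above the
    jump target, is the root of the pending subtree entered, and its parent \<open>vs ! i\<close>
    was marked before \<open>vs ! i'\<close>. Greediness then requires \<open>vs ! j'\<close> to be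
    marked already.\<close>
  have "s \<le> i'"
  proof (rule ccontr)
    assume "\<not> s \<le> i'"
    then have i': "i' \<le> r" using r by simp
    have vj: "(tparent b ^^ (j - s)) (vs ! Suc r) = vs ! j" using pow[of "j - s"] sj r by simp
    have "vs ! j \<notin> set (take (Suc r) vs)" using r sj ord full by (auto simp: in_set_conv_nth nth_eq)
    then have "tchildren n b (vs ! i') \<subseteq> set (take (Suc r) vs)"
      using greedy[unfolded greedy_jump_def, rule_format, OF i' ord(1), of "j - s"] vj p by simp
    moreover have "vs ! j' \<in> tchildren n b (vs ! i')"
      using p' ge2 nth_range[of j'] ord full by (simp add: tchildren_def)
    ultimately have "vs ! j' \<in> set (take (Suc r) vs)" by blast
    then show False using r sj ord full by (auto simp: in_set_conv_nth nth_eq)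
  qed
  \<comment> \<open>The climb from \<open>vs ! i'\<close> to \<open>vs ! j\<close> keeps the level,
    while the edge from \<open>vs ! i'\<close> to \<open>vs ! j'\<close> raises it by one because
    \<open>i' < j < j'\<close>.\<close>
  then show ?thesis using lev_climb[of i'] lev_long[of i' j'] ord p' ge2 by simp
qed

lemma planar_output: "planar {1..n} E"
proof -
  have "planar (set vs) E"
  \<comment> \<open>Labels grow from parent to child, so \<open>Max e\<close> recovers the child of
    a tree edge from the unordered pair.\<close>
  proof (rule planar_book_embedding[where col = "\<lambda>e. even (lev b vs (Max e))"])
    fix i i' j j'
    assume ord: "i < i'" "i' < j" "j < j'" "j' < length vs"
      and e: "{vs ! i, vs ! j} \<in> E" "{vs ! i', vs ! j'} \<in> E"
    \<comment> \<open>The closing edge joins the two extreme positions and crosses nothing;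
      \<open>i < i'\<close> excludes it as the second edge.\<close>
    have "j \<noteq> n - 1" using ord full by linarith
    have p: "vs ! i = tparent b (vs ! j)" "2 \<le> vs ! j" "vs ! i' = tparent b (vs ! j')" "2 \<le> vs ! j'"
      using long_edge[OF e(1)] long_edge[OF e(2)] ord full \<open>j \<noteq> n - 1\<close> by simp_all
    then have "Max {vs ! i, vs ! j} = vs ! j" "Max {vs ! i', vs ! j'} = vs ! j'"
      using tparent_less[of "vs ! j" b] tparent_less[of "vs ! j'" b] by (auto simp: max_def)
    then show "even (lev b vs (Max {vs ! i, vs ! j})) \<noteq> even (lev b vs (Max {vs ! i', vs ! j'}))"
      using lev_crossing[OF ord(1-3) _ p(1,3)] ord full by simp
  qed (use simple distinct_vs set_vs_eq in auto)
  then show ?thesis by (simp add: set_vs_eq)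
qed

section \<open>Hamiltonian cycle, degrees and diameter\<close>

lemma hamiltonian_output: "hamiltonian {1..n} E"
  unfolding hamiltonian_def
proof (intro exI[of _ vs] conjI)
  have "{vs ! k, vs ! Suc k} \<in> E" if k: "Suc k < length vs" for k
  proof -
    consider "case_a n b vs k" | "case_b n b vs k" | "case_c n b vs k" by (auto simp: case_c_def)
    then show ?thesis
    proof cases
      case 1
      then have "2 \<le> vs ! k" "vs ! k \<le> n" "vs ! Suc k = tparent b (vs ! k)"
        using step[OF k] nth_range[of k] k by (auto simp: greedy_step_def case_a_def)
      then show ?thesis using tree_edge[of "vs ! k"] by (simp add: insert_commute)
    next
      case 2
      then show ?thesis using step[OF k] tree_edge[of "vs ! Suc k"]
        by (auto simp: greedy_step_def tchildren_def)
    next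
      case 3
      then show ?thesis using k full by (auto simp: output_edges_def jump_edges_def)
    qed
  qed
  then show "walk E vs" using nonempty by (auto simp: walk_def)
  show "{last vs, hd vs} \<in> E"
    using nonempty start full by (simp add: output_edges_def last_conv_nth hd_conv_nth)
qed (use distinct_vs set_vs_eq full n3 in auto)

text \<open>The root has its children and the closing edge. A vertex that is a leaf, is last, or
  jumps away has at most one child and at most three neighbours. Any other vertex has only its
  children and its parent.\<close>

lemma degree_output:
  assumes "v \<in> {1..n}"
  shows "degree E v \<le> Suc b"
proof -
  obtain k where k: "k < n" "v = vs ! k" using assms set_vs_eq full by (metis in_set_conv_nth)
  define C where "C = tchildren n b v"
  have fin: "finite C" by (rule finite_subset[of _ "{..n}"]) (auto simp: C_def tchildren_def)
  have cardC: "card C \<le> b" using card_tchildren_le b2 by (simp add: C_def)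
  \<comment> \<open>This is the cyclic successor of \<open>v\<close> on the Hamiltonian
    cycle.\<close>
  define out where "out = (if k = n - 1 then vs ! 0 else vs ! Suc k)"
  have degree_le: "degree E v \<le> card N"
    if "finite N" "\<And>e. e \<in> E \<Longrightarrow> v \<in> e \<Longrightarrow> \<exists>x\<in>N. e = {v, x}" for N
  proof -
    have "{e \<in> E. v \<in> e} \<subseteq> (\<lambda>x. {v, x}) ` N" using that by blast
    then have "card {e \<in> E. v \<in> e} \<le> card ((\<lambda>x. {v, x}) ` N)"
      using that by (intro card_mono) auto
    also have "\<dots> \<le> card N" using that by (intro card_image_le)
    finally show ?thesis by (simp add: degree_def)
  qed
  have incident: "(\<exists>x\<in>C. e = {v, x}) \<or> (k \<noteq> 0 \<and> e = {v, tparent b v})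
      \<or> (k \<noteq> 0 \<and> C = {} \<and> e = {v, vs ! (k - 1)})
      \<or> ((k = n - 1 \<or> case_c n b vs k) \<and> e = {v, out})
      \<or> (k = 0 \<and> e = {v, vs ! (n - 1)})" if "e \<in> E" "v \<in> e" for e
    using that(1)
  proof (cases rule: edge_cases)
    case (tree x)
    then consider "v = x" | "v = tparent b x" using \<open>v \<in> e\<close> by auto
    then show ?thesis
    proof cases
      case 1
      then have "k \<noteq> 0" using tree k start by (intro notI) simp
      then show ?thesis using 1 tree by (auto simp: insert_commute)
    next
      case 2
      then have "x \<in> C" using tree by (simp add: C_def tchildren_def)
      then show ?thesis using 2 tree by auto
    qed
  next
    case (jump m)
    then consider "k = m" | "k = Suc m" using \<open>v \<in> e\<close> k full by (auto simp: nth_eq)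
    then show ?thesis
    proof cases
      case 1
      then show ?thesis using jump k by (auto simp: out_def)
    next
      case 2
      then have "tleaf n b v" using step[of m] jump k full by (simp add: greedy_step_def)
      then show ?thesis using 2 jump k by (auto simp: C_def tleaf_def)
    qed
  next
    case closing
    then have "k = n - 1 \<or> k = 0" using \<open>v \<in> e\<close> k full n3 by (auto simp: nth_eq)
    then show ?thesis using closing k by (auto simp: out_def)
  qed
  show ?thesis
  proof (cases "k = 0")
    case True
    \<comment> \<open>The root has the unmarked child 2 at the start, so no jump edge leaves
      it.\<close>
    have "2 \<in> C" using True k start n3 by (simp add: C_def tchildren_def tparent_def)
    moreover have "2 \<notin> set (take (Suc 0) vs)" using start nonempty by (cases vs) auto
    ultimately have "\<not> case_c n b vs 0"
      using True k by (auto simp: case_c_def case_b_def C_def)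
    then have "degree E v \<le> card (insert (vs ! (n - 1)) C)"
      using incident True n3 fin by (intro degree_le) auto
    then show ?thesis using cardC fin by (simp add: card_insert_if split: if_splits)
  next
    case False
    show ?thesis
    proof (cases "C = {} \<or> k = n - 1 \<or> case_c n b vs k")
      case True
      \<comment> \<open>All children are marked by now, and by \<open>climb_step\<close> a child
        marked before its parent immediately precedes it. The neighbours are then the parent, the
        predecessor and \<open>out\<close>.\<close>
      have "C \<subseteq> {vs ! (k - 1)}"
      proof
        fix c assume c: "c \<in> C"
        then have "c \<in> set (take (Suc k) vs)"
          using True k full set_vs_eq by (auto simp: case_c_def case_b_def C_def tchildren_def)
        then obtain i where i: "i \<le> k" "c = vs ! i" by (auto simp: in_set_conv_nth less_Suc_eq_le)
        have c2: "2 \<le> c" "tparent b c = v" using c by (auto simp: C_def tchildren_def)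
        then have "i \<noteq> k" using tparent_less[of c b] i k by auto
        then have "k = Suc i" using climb_step[of i k] i k c2 by simp
        then show "c \<in> {vs ! (k - 1)}" using i by simp
      qed
      then have "degree E v \<le> card {tparent b v, vs ! (k - 1), out}"
        using incident False by (intro degree_le) (simp, blast)
      also have "\<dots> \<le> 3" by (simp add: card_insert_if)
      finally show ?thesis using b2 by simp
    next
      case nC: False
      then have "degree E v \<le> card (insert (tparent b v) C)"
        using incident False fin by (intro degree_le) auto
      then show ?thesis using cardC fin by (simp add: card_insert_if split: if_splits)
    qed
  qed
qed

lemma walk_to_root:
  "x \<in> {1..n} \<Longrightarrow> \<exists>xs. walk E xs \<and> set xs \<subseteq> {1..n} \<and> hd xs = x \<and> last xs = 1 \<and>
     length xs = Suc (depth b x)"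
proof (induction x rule: less_induct)
  case (less x)
  show ?case
  proof (cases "x = 1")
    case True
    then show ?thesis using n3
      by (intro exI[of _ "[1]"]) (auto simp: walk_iff_successively depth.simps)
  next
    case False
    then have x: "2 \<le> x" "x \<le> n" using less.prems by auto
    then obtain xs where xs: "walk E xs" "set xs \<subseteq> {1..n}" "hd xs = tparent b x" "last xs = 1"
      "length xs = Suc (depth b (tparent b x))"
      using less.IH[of "tparent b x"] tparent_less[of x b] tparent_ge1[of b x] by auto
    show ?thesis using xs x tree_edge[of x]
      by (intro exI[of _ "x # xs"])
        (auto simp: walk_iff_successively successively_Cons insert_commute depth.simps[of b x])
  qed
qed

lemma diameter_output: "diameter {1..n} E \<le> enat (2 * height n (Suc b))"
  unfolding diameter_def
proof (intro SUP_least)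
  fix x y assume xy: "x \<in> {1..n}" "y \<in> {1..n}"
  have depth: "depth b z \<le> height n (Suc b)" if "z \<in> {1..n}" for z
    using that by (auto simp: height_def intro: Max_ge)
  obtain xs where xs: "walk E xs" "set xs \<subseteq> {1..n}" "hd xs = x" "last xs = 1"
    "length xs = Suc (depth b x)" using walk_to_root[OF xy(1)] by blast
  obtain ys where ys: "walk E ys" "set ys \<subseteq> {1..n}" "hd ys = y" "last ys = 1"
    "length ys = Suc (depth b y)" using walk_to_root[OF xy(2)] by blast
  have ne: "xs \<noteq> []" "ys \<noteq> []" using xs ys by (auto simp: walk_def)
  \<comment> \<open>The reversed walk loses its first vertex, so that joining the two walks does not
    repeat the root and the length is the sum of the two depths.\<close>
  obtain r where r: "rev ys = 1 # r" using ne ys by (metis hd_rev list.collapse rev_is_Nil_conv)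
  have sr: "successively (\<lambda>x y. {x, y} \<in> E) (1 # r)"
    using ys(1) unfolding r[symmetric] by (simp add: walk_iff_successively insert_commute)
  have "length r = depth b y" using ys r by (metis length_Cons length_rev nat.inject)
  moreover have "walk E (xs @ r)"
    using xs sr ne by (auto simp: walk_iff_successively successively_append_iff successively_Cons)
  moreover have "set (xs @ r) \<subseteq> {1..n}" using xs ys r by (metis Un_subset_iff set_append set_rev set_subset_Cons order_trans)
  moreover have "last (xs @ r) = y"
    using xs ys r ne by (metis last_appendR last_ConsL last_ConsR append_Nil2 last_rev)
  ultimately have "gdist {1..n} E x y \<le> enat (length (xs @ r) - 1)"
    unfolding gdist_def using xs ne by (intro INF_lower) auto
  also have "\<dots> \<le> enat (2 * height n (Suc b))"
    using depth[OF xy(1)] depth[OF xy(2)] xs \<open>length r = depth b y\<close> by simp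
  finally show "gdist {1..n} E x y \<le> enat (2 * height n (Suc b))" .
qed

end

theorem mainTheorem8:
  fixes n \<Delta> :: nat
  assumes "\<Delta> \<ge> 3" and "n \<ge> 3"
  shows "(\<exists>vs. execution n \<Delta> vs \<and> planar {1..n} (output_edges n \<Delta> vs)) \<and>
         (\<exists>(V :: nat set) (E :: nat set set). card V = n \<and> simple_graph V E \<and> planar V E \<and>
            hamiltonian V E \<and> (\<forall>v\<in>V. degree E v \<le> \<Delta>) \<and>
            diameter V E \<le> enat (2 * height n \<Delta>))"
proof -
  obtain b where b: "\<Delta> = Suc b" "2 \<le> b" using assms(1) by (cases \<Delta>) auto
  obtain vs where "greedy_run n b vs" "length vs = n" using ex_greedy_run[of n n b] assms(2) by auto
  then interpret greedy_traversal n b vs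
    using assms(2) b by (simp add: greedy_traversal_def greedy_traversal_axioms_def)
  show ?thesis
    unfolding b(1)
    using greedy_execution planar_output simple hamiltonian_output degree_output diameter_output
    by (intro conjI exI[of _ vs] exI[of _ "{1..n}"] exI[of _ E]) auto
qed

end
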